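(* Fix $0\le B<1$ and a positive number $i_0$ with $\frac{B}{4i_0}<\frac12$. For integers $i\ge1$ let $$p_i=\begin{cases}\frac12-\frac{B}{4i}, & i>i_0,\\ \frac12, & i\le i_0,\end{cases}$$ let $\{Z_n\}_{n\ge0}$ be the associated branching process with one immigrant per generation, and let $C=\{n\ge0: Z_n=0\}$. Then there is a constant $c>0$ such that $$\lim_{n\to\infty}\frac{E\,\#\{k: k\in C\cap[0,n]\}}{\log n}=c,$$ and for all $\varepsilon>0$, $$\lim_{n\to\infty}\frac{\#\{k: k\in C\cap[0,n]\}}{(\log n)^{1+\varepsilon}}=0\quad\text{almost surely.}$$
   Context: Given numbers $0<p_k\le 1/2$, $k\ge1$, put $q_k=1-p_k$ and $f_k(s)=\frac{p_k}{1-q_ks}$ for $s\in[0,1]$ (a geometric probability generating function). Let $\{Z_n\}_{n\ge0}$ be a Markov chain with values in $\{0,1,2,\dots\}$ such that $Z_0=0$ and $$E\left(s^{Z_n}\mid Z_0,\dots,Z_{n-1}\right)=[f_n(s)]^{1+Z_{n-1}},\qquad n\ge1,\ s\in[0,1].$$ This is a branching process in varying environment with exactly one immigrant in each generation. The elements of $C=\{n\ge0: Z_n=0\}$ are called regeneration times. The notation $\#\{\cdot\}$ denotes the number of elements of a set. *)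

theory Defs
  imports "HOL-Probability.Probability"
begin

definition sigma_gen :: "'a measure \<Rightarrow> (nat \<Rightarrow> 'a \<Rightarrow> nat) \<Rightarrow> nat set \<Rightarrow> 'a measure" where
  "sigma_gen M Z I =
     vimage_algebra (space M) (\<lambda>\<omega>. \<lambda>i\<in>I. Z i \<omega>) (\<Pi>\<^sub>M i\<in>I. count_space UNIV)"

text \<open>The library's \<open>real_cond_exp M F\<close> is meaningful only if \<open>F\<close> is a subalgebra of \<open>M\<close>.\<close>

lemma subalgebra_sigma_gen:
  assumes "\<And>i. i \<in> I \<Longrightarrow> Z i \<in> measurable M (count_space UNIV)"
  shows "subalgebra M (sigma_gen M Z I)"
proof -
  have "(\<lambda>\<omega>. \<lambda>i\<in>I. Z i \<omega>) \<in> measurable M (\<Pi>\<^sub>M i\<in>I. count_space UNIV)"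
    using assms by (rule measurable_restrict)
  then have "sets (sigma_gen M Z I) \<subseteq> sets M"
    unfolding sigma_gen_def by (intro sets_image_in_sets) auto
  then show ?thesis
    by (simp add: subalgebra_def sigma_gen_def)
qed

definition markov_chain :: "'a measure \<Rightarrow> (nat \<Rightarrow> 'a \<Rightarrow> nat) \<Rightarrow> bool" where
  "markov_chain M Z \<longleftrightarrow>
     (\<forall>n. Z n \<in> measurable M (count_space UNIV)) \<and>
     (\<forall>n j. AE \<omega> in M.
        real_cond_exp M (sigma_gen M Z {..n}) (indicator {\<omega>. Z (Suc n) \<omega> = j}) \<omega> =
        real_cond_exp M (sigma_gen M Z {n}) (indicator {\<omega>. Z (Suc n) \<omega> = j}) \<omega>)"

definition geom_pgf :: "real \<Rightarrow> real \<Rightarrow> real" where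
  "geom_pgf p s = p / (1 - (1 - p) * s)"

text \<open>The value \<open>p 0\<close> is never used.\<close>

locale branching_with_immigration = prob_space M for M :: "'a measure" +
  fixes p :: "nat \<Rightarrow> real" and Z :: "nat \<Rightarrow> 'a \<Rightarrow> nat"
  assumes p_bounds: "\<And>k. k \<ge> 1 \<Longrightarrow> 0 < p k \<and> p k \<le> 1 / 2"
    and markov: "markov_chain M Z"
    and start: "AE \<omega> in M. Z 0 \<omega> = 0"
    and cond_pgf: "\<And>n s. n \<ge> 1 \<Longrightarrow> s \<in> {0..1} \<Longrightarrow>
      AE \<omega> in M. real_cond_exp M (sigma_gen M Z {..<n}) (\<lambda>\<omega>. s ^ Z n \<omega>) \<omega> =
                 geom_pgf (p n) s ^ (1 + Z (n - 1) \<omega>)"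

definition regeneration_times :: "(nat \<Rightarrow> 'a \<Rightarrow> nat) \<Rightarrow> 'a \<Rightarrow> nat set" where
  "regeneration_times Z \<omega> = {n. Z n \<omega> = 0}"

end

theory Submission
  imports Defs "HOL-Real_Asymp.Real_Asymp"
begin

text \<open>
  In the coordinate \<open>u = 1 / (1 - s)\<close> the geometric generating function becomes the affine map
  \<open>u \<mapsto> 1 + (p / q) u\<close>, so the generating function of \<open>Z\<^sub>n\<close> is explicit:
  \<open>P(Z\<^sub>n = 0) = D\<^sub>n / (D\<^sub>0 + \<dots> + D\<^sub>n)\<close> with \<open>D\<^sub>n = \<Prod>\<^sub>i\<^sub>\<le>\<^sub>n p\<^sub>i / q\<^sub>i\<close>. By the Stolz-Cesaro theorem this is
  asymptotic to \<open>(1 - B) / n\<close>, which gives the expectation with \<open>c = 1 - B\<close>. Along \<open>n = 2 ^ 2 ^ j\<close> the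
  expectations of the normalised counts are summable, so these counts tend to 0 almost surely;
  monotonicity of the count fills the gaps.
\<close>

section \<open>Weighted Cesaro averages\<close>

text \<open>The finitely many indices where \<open>x\<close> is still far from \<open>L\<close>
  contribute a fixed amount to the weighted deviation, and the diverging total weight swallows it.
  It is applied twice, with weights \<open>odds_prod p k\<close> and with weights
  \<open>1 / (k + 1)\<close>.\<close>

lemma weighted_average_tendsto:
  fixes w x :: "nat \<Rightarrow> real"
  assumes w: "\<And>n. w n \<ge> 0"
    and W: "filterlim (\<lambda>n. \<Sum>k<n. w k) at_top sequentially"
    and x: "x \<longlonglongrightarrow> L"
  shows "(\<lambda>n. (\<Sum>k<n. w k * x k) / (\<Sum>k<n. w k)) \<longlonglongrightarrow> L"
proof (rule LIMSEQ_I)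
  fix e :: real assume e: "e > 0"
  then obtain N where N: "\<And>k. k \<ge> N \<Longrightarrow> \<bar>x k - L\<bar> < e / 2"
    using LIMSEQ_D[OF x, of "e / 2"] by auto
  define A where "A = (\<Sum>k<N. w k * \<bar>x k - L\<bar>)"
  have bound: "(\<Sum>k<n. w k * \<bar>x k - L\<bar>) \<le> A + e / 2 * (\<Sum>k<n. w k)" for n
  proof -
    have "(\<Sum>k<n. w k * \<bar>x k - L\<bar>)
      \<le> (\<Sum>k<n. (if k < N then w k * \<bar>x k - L\<bar> else 0) + e / 2 * w k)"
    proof (rule sum_mono)
      fix k
      show "w k * \<bar>x k - L\<bar> \<le> (if k < N then w k * \<bar>x k - L\<bar> else 0) + e / 2 * w k"
        using mult_left_mono[OF less_imp_le[OF N[of k]] w[of k]] w[of k] e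
        by (auto simp: mult.commute)
    qed
    also have "\<dots> = (\<Sum>k<n. if k < N then w k * \<bar>x k - L\<bar> else 0) + e / 2 * (\<Sum>k<n. w k)"
      by (simp add: sum.distrib sum_distrib_left)
    also have "(\<Sum>k<n. if k < N then w k * \<bar>x k - L\<bar> else 0)
        = (\<Sum>k\<in>{..<n} \<inter> {..<N}. w k * \<bar>x k - L\<bar>)"
      by (subst sum.inter_restrict) auto
    also have "\<dots> \<le> A"
      unfolding A_def by (intro sum_mono2) (auto intro!: mult_nonneg_nonneg w)
    finally show ?thesis by simp
  qed
  \<comment> \<open>The bound \<open>2 * A / e\<close> makes \<open>A\<close> less than half of the
    allowed error \<open>e * (\<Sum>k<n. w k)\<close>; the bound 0 permits division by the total
    weight.\<close>
  have "eventually (\<lambda>n. (\<Sum>k<n. w k) > max 0 (2 * A / e)) sequentially"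
    using W unfolding filterlim_at_top_dense by blast
  then obtain N' where N': "\<And>n. n \<ge> N' \<Longrightarrow> (\<Sum>k<n. w k) > max 0 (2 * A / e)"
    by (auto simp: eventually_sequentially)
  show "\<exists>no. \<forall>n\<ge>no. norm ((\<Sum>k<n. w k * x k) / (\<Sum>k<n. w k) - L) < e"
  proof (intro exI allI impI)
    fix n assume n: "n \<ge> N'"
    have pos: "(\<Sum>k<n. w k) > 0" and large: "A < e / 2 * (\<Sum>k<n. w k)"
      using N'[OF n] e by (auto simp: field_simps)
    have "(\<Sum>k<n. w k * x k) / (\<Sum>k<n. w k) - L = (\<Sum>k<n. w k * (x k - L)) / (\<Sum>k<n. w k)"
      using pos by (simp add: field_simps sum_subtractf sum_distrib_left)
    moreover have "\<bar>\<Sum>k<n. w k * (x k - L)\<bar> \<le> (\<Sum>k<n. w k * \<bar>x k - L\<bar>)"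
      using sum_abs[of "\<lambda>k. w k * (x k - L)" "{..<n}"] by (simp add: abs_mult w)
    moreover have "\<dots> < e * (\<Sum>k<n. w k)"
      using bound[of n] large by linarith
    ultimately show "norm ((\<Sum>k<n. w k * x k) / (\<Sum>k<n. w k) - L) < e"
      using pos by (simp add: abs_div pos_divide_less_eq)
  qed
qed

section \<open>Generating function of the process\<close>

text \<open>The slope of the affine map to which the first \<open>n\<close> generating functions
  compose in the coordinate \<open>u = 1 / (1 - s)\<close>.\<close>

definition odds_prod :: "(nat \<Rightarrow> real) \<Rightarrow> nat \<Rightarrow> real" where
  "odds_prod p n = (\<Prod>i=1..n. p i / (1 - p i))"

lemma odds_prod_0 [simp]: "odds_prod p 0 = 1"
  by (simp add: odds_prod_def)

lemma odds_prod_Suc: "odds_prod p (Suc n) = odds_prod p n * (p (Suc n) / (1 - p (Suc n)))"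
  by (simp add: odds_prod_def)

context branching_with_immigration
begin

lemma Z_measurable [measurable]: "Z n \<in> measurable M (count_space UNIV)"
  using markov by (simp add: markov_chain_def)

lemma odds_prod_pos: "odds_prod p n > 0"
  unfolding odds_prod_def
proof (rule prod_pos)
  fix i assume "i \<in> {1..n}"
  then have "0 < p i" "p i \<le> 1 / 2" using p_bounds[of i] by auto
  then show "0 < p i / (1 - p i)" by simp
qed

text \<open>Keeps the argument in the half-open interval where \<open>u\<close> is finite, so that
  the recursion for the generating function can be iterated.\<close>

lemma geom_pgf_range:
  assumes "k \<ge> 1" "0 \<le> s" "s < 1"
  shows "0 \<le> geom_pgf (p k) s" "geom_pgf (p k) s < 1"
proof -
  have p: "0 < p k" "p k \<le> 1 / 2" using p_bounds[OF assms(1)] by auto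
  have "(1 - p k) * s < (1 - p k) * 1"
    using p assms by (intro mult_strict_left_mono) auto
  then have "1 - (1 - p k) * s > p k" by simp
  moreover from this p have "1 - (1 - p k) * s > 0" by linarith
  ultimately show "0 \<le> geom_pgf (p k) s" "geom_pgf (p k) s < 1"
    using p by (auto simp: geom_pgf_def)
qed

text \<open>The affine form of the generating function, with \<open>u' = 1 / (1 - f(s))\<close> as
  the new coordinate. The immigrant contributes an extra factor \<open>f(s) = 1 - 1 / u'\<close>,
  and \<open>f(s) * u' = u' - 1\<close> removes exactly the constant term of the affine map.\<close>

lemma inverse_one_minus_geom_pgf:
  assumes "k \<ge> 1" "0 \<le> s" "s < 1"
  shows "1 / (1 - geom_pgf (p k) s) = 1 + p k / (1 - p k) * (1 / (1 - s))"
    and "geom_pgf (p k) s * (1 / (1 - geom_pgf (p k) s)) = p k / (1 - p k) * (1 / (1 - s))"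
proof -
  have p: "0 < p k" "p k \<le> 1 / 2" using p_bounds[OF assms(1)] by auto
  have "(1 - p k) * s < (1 - p k) * 1"
    using p assms by (intro mult_strict_left_mono) auto
  then have "1 - (1 - p k) * s > p k" by simp
  then have d: "1 - (1 - p k) * s > 0" using p by linarith
  have q: "1 - p k > 0" "1 - s > 0" using p assms by auto
  have "1 - geom_pgf (p k) s = (1 - p k) * (1 - s) / (1 - (1 - p k) * s)"
    using d by (simp add: geom_pgf_def field_simps)
  then have i: "1 / (1 - geom_pgf (p k) s) = (1 - (1 - p k) * s) / ((1 - p k) * (1 - s))"
    by simp
  show "1 / (1 - geom_pgf (p k) s) = 1 + p k / (1 - p k) * (1 / (1 - s))"
    unfolding i using q by (simp add: divide_simps) (simp add: algebra_simps)
  show "geom_pgf (p k) s * (1 / (1 - geom_pgf (p k) s)) = p k / (1 - p k) * (1 / (1 - s))"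
    unfolding i using d by (simp add: geom_pgf_def)
qed

lemma integrable_power_Z:
  assumes "0 \<le> s" "s \<le> 1"
  shows "integrable M (\<lambda>\<omega>. s ^ Z n \<omega> :: real)"
  by (rule integrable_const_bound[of _ 1]) (use assms in \<open>auto intro!: AE_I2 power_le_one\<close>)

text \<open>Tower property applied to the conditional generating function; the immigrant accounts
  for the factor outside the expectation.\<close>

lemma expectation_pgf_Suc:
  assumes s: "0 \<le> s" "s < 1"
  shows "expectation (\<lambda>\<omega>. s ^ Z (Suc n) \<omega>) = geom_pgf (p (Suc n)) s *
    expectation (\<lambda>\<omega>. geom_pgf (p (Suc n)) s ^ Z n \<omega>)"
proof -
  let ?F = "sigma_gen M Z {..<Suc n}"
  have sub: "subalgebra M ?F"
    by (rule subalgebra_sigma_gen) (rule Z_measurable)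
  interpret F: finite_measure_subalgebra M ?F
    by unfold_locales (rule sub)
  have "expectation (\<lambda>\<omega>. s ^ Z (Suc n) \<omega>) =
      expectation (real_cond_exp M ?F (\<lambda>\<omega>. s ^ Z (Suc n) \<omega>))"
    using s by (intro F.real_cond_exp_int(2)[symmetric] integrable_power_Z) auto
  also have "\<dots> = expectation (\<lambda>\<omega>. geom_pgf (p (Suc n)) s ^ (1 + Z n \<omega>))"
    using cond_pgf[of "Suc n" s] s
    by (intro integral_cong_AE) auto
  finally show ?thesis by simp
qed

text \<open>With \<open>r\<close> the odds of generation \<open>n + 1\<close>, passing from
  \<open>u\<close> to \<open>1 + r * u\<close> splits \<open>D n * (1 + r * u)\<close> into
  \<open>D n\<close>, which joins the sum, and \<open>D (n + 1) * u\<close>. The induction leaves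
  \<open>s\<close> arbitrary because the hypothesis is used at the image of
  \<open>s\<close>.\<close>

lemma expectation_pgf:
  assumes "0 \<le> s" "s < 1"
  shows "expectation (\<lambda>\<omega>. s ^ Z n \<omega>) = odds_prod p n * (1 / (1 - s)) /
    ((\<Sum>k<n. odds_prod p k) + odds_prod p n * (1 / (1 - s)))"
  using assms
proof (induction n arbitrary: s)
  case 0
  have "expectation (\<lambda>\<omega>. s ^ Z 0 \<omega>) = expectation (\<lambda>\<omega>. 1)"
    using start by (intro integral_cong_AE) auto
  then show ?case using 0 by (simp add: prob_space)
next
  case (Suc n)
  define t where "t = geom_pgf (p (Suc n)) s"
  have t: "0 \<le> t" "t < 1"
    using geom_pgf_range[of "Suc n" s] Suc.prems by (auto simp: t_def)
  define r where "r = p (Suc n) / (1 - p (Suc n))"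
  have "expectation (\<lambda>\<omega>. s ^ Z (Suc n) \<omega>) = t * expectation (\<lambda>\<omega>. t ^ Z n \<omega>)"
    unfolding t_def using Suc.prems by (rule expectation_pgf_Suc)
  also have "\<dots> = odds_prod p n * (t * (1 / (1 - t))) /
      ((\<Sum>k<n. odds_prod p k) + odds_prod p n * (1 / (1 - t)))"
    using Suc.IH[OF t] by simp
  also have "t * (1 / (1 - t)) = r * (1 / (1 - s))"
    unfolding t_def r_def using Suc.prems by (intro inverse_one_minus_geom_pgf) auto
  also have "1 / (1 - t) = 1 + r * (1 / (1 - s))"
    unfolding t_def r_def using Suc.prems by (intro inverse_one_minus_geom_pgf) auto
  finally show ?case
    by (simp add: odds_prod_Suc r_def[symmetric] algebra_simps)
qed

lemma prob_zero:
  "prob {\<omega> \<in> space M. Z n \<omega> = 0} = odds_prod p n / (\<Sum>k<Suc n. odds_prod p k)"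
proof -
  have "prob {\<omega> \<in> space M. Z n \<omega> = 0} = expectation (indicator {\<omega> \<in> space M. Z n \<omega> = 0})"
    by simp
  \<comment> \<open>Since \<open>0 ^ 0 = 1\<close>, this power is the indicator of
    \<open>Z n = 0\<close>. At \<open>s = 0\<close> the coordinate is \<open>u = 1\<close>, so the
    denominator becomes the sum up to and including \<open>n\<close>.\<close>
  also have "\<dots> = expectation (\<lambda>\<omega>. 0 ^ Z n \<omega>)"
    by (intro Bochner_Integration.integral_cong) (auto simp: indicator_def)
  also have "\<dots> = odds_prod p n / (\<Sum>k<Suc n. odds_prod p k)"
    by (subst expectation_pgf) auto
  finally show ?thesis .
qed

section \<open>Counting regeneration times\<close>

lemma card_regeneration_times:
  "real (card (regeneration_times Z \<omega> \<inter> {0..n})) = (\<Sum>k\<le>n. of_bool (Z k \<omega> = 0))"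
proof -
  have "regeneration_times Z \<omega> \<inter> {0..n} = {..n} \<inter> {k. Z k \<omega> = 0}"
    by (auto simp: regeneration_times_def)
  then show ?thesis by (simp add: sum_of_bool_eq)
qed

lemma integrable_card_regeneration_times:
  "integrable M (\<lambda>\<omega>. real (card (regeneration_times Z \<omega> \<inter> {0..n})))"
  unfolding card_regeneration_times
  by (intro Bochner_Integration.integrable_sum integrable_const_bound[of _ 1]) auto

lemma expectation_card_regeneration_times:
  "expectation (\<lambda>\<omega>. real (card (regeneration_times Z \<omega> \<inter> {0..n}))) =
    (\<Sum>k\<le>n. odds_prod p k / (\<Sum>j<Suc k. odds_prod p j))"
proof -
  have "expectation (\<lambda>\<omega>. real (card (regeneration_times Z \<omega> \<inter> {0..n}))) =
    (\<Sum>k\<le>n. expectation (\<lambda>\<omega>. of_bool (Z k \<omega> = 0)))"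
    unfolding card_regeneration_times
    by (intro Bochner_Integration.integral_sum integrable_const_bound[of _ 1]) auto
  also have "\<dots> = (\<Sum>k\<le>n. prob {\<omega> \<in> space M. Z k \<omega> = 0})"
  proof (rule sum.cong)
    fix k
    have "expectation (\<lambda>\<omega>. of_bool (Z k \<omega> = 0)) =
        expectation (indicator {\<omega> \<in> space M. Z k \<omega> = 0})"
      by (intro Bochner_Integration.integral_cong) (auto simp: indicator_def)
    also have "\<dots> = prob {\<omega> \<in> space M. Z k \<omega> = 0}" by simp
    finally show "expectation (\<lambda>\<omega>. of_bool (Z k \<omega> = 0)) = prob {\<omega> \<in> space M. Z k \<omega> = 0}" .
  qed simp
  finally show ?thesis by (simp only: prob_zero)
qed

text \<open>Along \<open>2 ^ 2 ^ j\<close> the logarithm doubles at each step: sparse enough for the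
  normalised expectations to decay geometrically, dense enough for neighbouring normalisations to
  differ by a bounded factor.\<close>

lemma card_regeneration_times_almost_surely:
  fixes c \<epsilon> :: real
  assumes lim: "(\<lambda>n. expectation (\<lambda>\<omega>. real (card (regeneration_times Z \<omega> \<inter> {0..n}))) / ln (real n))
      \<longlonglongrightarrow> c"
    and \<epsilon>: "\<epsilon> > 0"
  shows "AE \<omega> in M.
    (\<lambda>n. real (card (regeneration_times Z \<omega> \<inter> {0..n})) / ln (real n) powr (1 + \<epsilon>)) \<longlonglongrightarrow> 0"
proof -
  define N where "N n \<omega> = real (card (regeneration_times Z \<omega> \<inter> {0..n}))" for n \<omega>
  define l where "l j = ln (real (2 ^ 2 ^ j))" for j :: nat
  have l: "l j = 2 ^ j * ln 2" for j
    by (simp add: l_def ln_realpow)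
  have l_pos: "l j > 0" for j by (simp add: l)
  obtain K where K: "\<And>n. \<bar>expectation (N n) / ln (real n)\<bar> \<le> K"
    using convergent_imp_Bseq[OF convergentI[OF lim]] unfolding N_def Bseq_def by auto
  have int: "integrable M (N n)" for n
    unfolding N_def by (rule integrable_card_regeneration_times)
  have N_nonneg: "N n \<omega> \<ge> 0" for n \<omega> by (simp add: N_def)
  define X where "X j \<omega> = N (2 ^ 2 ^ j) \<omega> / l j powr (1 + \<epsilon>)" for j \<omega>
  have X_nonneg: "X j \<omega> \<ge> 0" for j \<omega> by (simp add: X_def N_nonneg)
  have X_int: "integrable M (X j)" for j unfolding X_def using int by simp
  have EX: "expectation (X j) \<le> K * ln 2 powr (-\<epsilon>) * (2 powr (-\<epsilon>)) ^ j" for j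
  proof -
    \<comment> \<open>One power of \<open>l j\<close> is absorbed by the bound \<open>K\<close>; the
      remaining \<open>l j powr (-\<epsilon>)\<close> is geometric in \<open>j\<close> with ratio
      \<open>2 powr (-\<epsilon>) < 1\<close>.\<close>
    have "expectation (X j) = expectation (N (2 ^ 2 ^ j)) / l j * l j powr (-\<epsilon>)"
      unfolding X_def using l_pos[of j]
      by (simp add: powr_add powr_minus divide_inverse mult.assoc)
    also have "\<dots> \<le> K * l j powr (-\<epsilon>)"
      unfolding l_def using order_trans[OF abs_ge_self K[of "2 ^ 2 ^ j"]]
      by (rule mult_right_mono) simp
    also have "l j powr (-\<epsilon>) = ln 2 powr (-\<epsilon>) * (2 powr (-\<epsilon>)) ^ j"
      by (simp add: l powr_mult powr_realpow[symmetric] powr_powr mult.commute)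
    finally show ?thesis by simp
  qed
  have "summable (\<lambda>j. K * ln 2 powr (-\<epsilon>) * (2 powr (-\<epsilon>)) ^ j)"
    using \<epsilon> by (intro summable_mult summable_geometric) (simp add: powr_less_one)
  then have sumEX: "summable (\<lambda>j. expectation (X j))"
    by (rule summable_comparison_test'[where N = 0])
       (use EX X_nonneg in \<open>auto simp: abs_of_nonneg\<close>)
  have "AE \<omega> in M. summable (\<lambda>j. X j \<omega>)"
  proof -
    \<comment> \<open>Nonnegative terms allow sum and integral to be exchanged; a sum with finite
      integral is finite almost everywhere, so its terms tend to 0 there.\<close>
    have "(\<integral>\<^sup>+\<omega>. (\<Sum>j. ennreal (X j \<omega>)) \<partial>M) = (\<Sum>j. \<integral>\<^sup>+\<omega>. ennreal (X j \<omega>) \<partial>M)"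
      using X_int by (intro nn_integral_suminf) auto
    also have "\<dots> = (\<Sum>j. ennreal (expectation (X j)))"
      using X_int X_nonneg by (simp add: nn_integral_eq_integral)
    also have "\<dots> = ennreal (\<Sum>j. expectation (X j))"
      using sumEX X_nonneg by (intro suminf_ennreal2) auto
    finally have "(\<integral>\<^sup>+\<omega>. (\<Sum>j. ennreal (X j \<omega>)) \<partial>M) \<noteq> \<infinity>" by simp
    then have "AE \<omega> in M. (\<Sum>j. ennreal (X j \<omega>)) \<noteq> \<infinity>"
      using X_int by (intro nn_integral_PInf_AE) auto
    then show ?thesis
      by (rule AE_mp) (auto intro!: AE_I2 summable_suminf_not_top X_nonneg simp: infinity_ennreal_def)
  qed
  then show ?thesis
  proof (rule AE_mp, intro AE_I2 impI)
    fix \<omega> assume "summable (\<lambda>j. X j \<omega>)"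
    then have X0: "(\<lambda>j. X j \<omega>) \<longlonglongrightarrow> 0" by (rule summable_LIMSEQ_zero)
    \<comment> \<open>Index of the block containing \<open>n\<close>; from \<open>n = 2\<close> on
      the iterated logarithm is nonnegative, so \<open>nat\<close> truncates nothing.\<close>
    define J where "J n = nat \<lfloor>log 2 (log 2 (real n))\<rfloor>" for n :: nat
    have J: "2 ^ 2 ^ J n \<le> n" "n \<le> 2 ^ 2 ^ Suc (J n)" if "n \<ge> 2" for n
    proof -
      have lg: "log 2 (real n) \<ge> 1" using that by simp
      define y where "y = log 2 (log 2 (real n))"
      have y: "y \<ge> 0" using lg by (simp add: y_def)
      have J_le: "real (J n) \<le> y" "y < real (Suc (J n))"
        using y unfolding J_def y_def[symmetric] by linarith+
      have py: "2 powr y = log 2 (real n)" using lg by (simp add: y_def)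
      have pn: "2 powr (2 powr y) = real n" using that py by simp
      have pp: "2 powr (2 powr real k) = real (2 ^ 2 ^ k)" for k :: nat
        by (simp add: powr_realpow del: of_nat_power)
           (metis of_nat_numeral of_nat_power powr_realpow zero_less_numeral)
      have "real (2 ^ 2 ^ J n) \<le> real n"
        unfolding pp[symmetric] pn[symmetric] using J_le by (intro powr_mono) auto
      then show "2 ^ 2 ^ J n \<le> n" by (simp only: of_nat_le_iff)
      have "real n \<le> real (2 ^ 2 ^ Suc (J n))"
        unfolding pp[symmetric] pn[symmetric] using J_le by (intro powr_mono less_imp_le) auto
      then show "n \<le> 2 ^ 2 ^ Suc (J n)" by (simp only: of_nat_le_iff)
    qed
    have J_lim: "filterlim J at_top sequentially"
      unfolding J_def by real_asymp
    \<comment> \<open>The count is bounded at the right end of the block and the logarithm at its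
      left end; the latter is half the logarithm at the right end, whence the constant.\<close>
    have up: "N n \<omega> / ln (real n) powr (1 + \<epsilon>) \<le> 2 powr (1 + \<epsilon>) * X (Suc (J n)) \<omega>"
      if n: "n \<ge> 2" for n
    proof -
      have "l (J n) \<le> ln (real n)"
        unfolding l_def using J(1)[OF n] by (subst ln_le_cancel_iff) (use n in \<open>auto simp del: of_nat_power\<close>)
      then have "l (J n) powr (1 + \<epsilon>) \<le> ln (real n) powr (1 + \<epsilon>)"
        using l_pos[of "J n"] \<epsilon> by (intro powr_mono2) auto
      moreover have "N n \<omega> \<le> N (2 ^ 2 ^ Suc (J n)) \<omega>"
        unfolding N_def using J(2)[OF n] by (intro of_nat_mono card_mono) auto
      ultimately have "N n \<omega> / ln (real n) powr (1 + \<epsilon>) \<le>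
          N (2 ^ 2 ^ Suc (J n)) \<omega> / l (J n) powr (1 + \<epsilon>)"
        using l_pos[of "J n"] N_nonneg by (intro frac_le) auto
      also have "l (Suc (J n)) powr (1 + \<epsilon>) = 2 powr (1 + \<epsilon>) * l (J n) powr (1 + \<epsilon>)"
        using l_pos[of "J n"] by (simp add: l powr_mult)
      then have "N (2 ^ 2 ^ Suc (J n)) \<omega> / l (J n) powr (1 + \<epsilon>) =
          2 powr (1 + \<epsilon>) * X (Suc (J n)) \<omega>"
        by (simp add: X_def)
      finally show ?thesis .
    qed
    have "(\<lambda>n. X (Suc (J n)) \<omega>) \<longlonglongrightarrow> 0"
      using filterlim_compose[OF LIMSEQ_Suc[OF X0] J_lim] .
    then have "(\<lambda>n. 2 powr (1 + \<epsilon>) * X (Suc (J n)) \<omega>) \<longlonglongrightarrow> 0"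
      by (rule tendsto_mult_right_zero)
    then have "(\<lambda>n. N n \<omega> / ln (real n) powr (1 + \<epsilon>)) \<longlonglongrightarrow> 0"
      by (rule tendsto_sandwich[OF _ _ tendsto_const, rotated 2])
         (use up in \<open>auto intro!: eventually_sequentiallyI[of 2] divide_nonneg_nonneg N_nonneg\<close>)
    then show "(\<lambda>n. real (card (regeneration_times Z \<omega> \<inter> {0..n})) / ln (real n) powr (1 + \<epsilon>)) \<longlonglongrightarrow> 0"
      by (simp add: N_def)
  qed
qed

end

section \<open>Asymptotics for the given parameters\<close>

text \<open>The difference \<open>harm n - ln n\<close> converges to Euler's constant. The shift to
  \<open>Suc n\<close> fits the \<open>n + 1\<close> times in \<open>[0, n]\<close>.\<close>

lemma harm_over_ln_tendsto: "(\<lambda>n. harm (Suc n) / ln (real n)) \<longlonglongrightarrow> (1::real)"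
proof -
  have "(\<lambda>n. (harm n - ln (real n)) / ln (real n)) \<longlonglongrightarrow> (0::real)"
    by (rule tendsto_divide_0[OF euler_mascheroni_LIMSEQ])
       (rule filterlim_at_top_imp_at_infinity, real_asymp)
  moreover have "(\<lambda>n. 1 + inverse (real (Suc n)) / ln (real n)) \<longlonglongrightarrow> 1"
    by real_asymp
  ultimately have "(\<lambda>n. (harm n - ln (real n)) / ln (real n) +
      (1 + inverse (real (Suc n)) / ln (real n))) \<longlonglongrightarrow> 0 + (1::real)"
    by (rule tendsto_add)
  moreover have "eventually (\<lambda>n. (harm n - ln (real n)) / ln (real n) +
      (1 + inverse (real (Suc n)) / ln (real n)) = harm (Suc n) / ln (real n)) sequentially"
    using eventually_gt_at_top[of 1]
    by eventually_elim (simp add: harm_Suc add_divide_distrib diff_divide_distrib)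
  ultimately show ?thesis
    by (simp add: filterlim_cong)
qed

lemma odds_harmonic:
  fixes B x :: real
  assumes "0 \<le> B" "B < 1" "x \<ge> 1"
  shows "(1 / 2 - B / (4 * x)) / (1 - (1 / 2 - B / (4 * x))) = (2 * x - B) / (2 * x + B)"
proof -
  have "1 / 2 - B / (4 * x) = (2 * x - B) / (4 * x)"
    "1 - (1 / 2 - B / (4 * x)) = (2 * x + B) / (4 * x)"
    using assms by (auto simp: field_simps)
  then show ?thesis using assms by simp
qed

text \<open>Writing \<open>D\<close> for the products and \<open>S n\<close> for the sum of the
  first \<open>n\<close>, the increments of \<open>k * D k\<close> are \<open>D k\<close> times a
  factor tending to \<open>1 - B\<close>. Hence \<open>n * D n / S n\<close> is a weighted average
  of these factors, provided that \<open>S\<close> diverges.\<close>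

lemma odds_prod_over_sum_tendsto:
  fixes p :: "nat \<Rightarrow> real" and B i0 :: real
  assumes B: "0 \<le> B" "B < 1"
    and p: "\<And>i. i \<ge> 1 \<Longrightarrow> p i = (if real i > i0 then 1 / 2 - B / (4 * real i) else 1 / 2)"
    and pos: "\<And>n. odds_prod p n > 0"
  shows "(\<lambda>n. real (Suc n) * (odds_prod p n / (\<Sum>k<Suc n. odds_prod p k))) \<longlonglongrightarrow> 1 - B"
proof -
  define D where "D = odds_prod p"
  define S where "S n = (\<Sum>k<n. D k)" for n
  define r where "r i = p i / (1 - p i)" for i
  have D_Suc: "D (Suc n) = D n * r (Suc n)" for n
    by (simp add: D_def r_def odds_prod_Suc)
  have D_pos: "D n > 0" for n using pos by (simp add: D_def)
  have r: "r i = (if real i > i0 then (2 * real i - B) / (2 * real i + B) else 1)" if "i \<ge> 1" for i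
    using p[OF that] odds_harmonic[OF B, of "real i"] that by (auto simp: r_def)
  \<comment> \<open>In other words \<open>n * D n\<close> is nondecreasing, which follows from
    \<open>B < 1\<close>. So \<open>D n\<close> dominates a multiple of \<open>1 / n\<close>, and
    the harmonic series forces \<open>S\<close> to diverge.\<close>
  have r_ge: "real (Suc n) * r (Suc n) \<ge> real n" for n
  proof (cases "real (Suc n) > i0")
    case True
    have "real n * (2 * real (Suc n) + B) \<le> real (Suc n) * (2 * real (Suc n) - B)"
      using B mult_right_mono[of B 1 "real n"] by (simp add: algebra_simps)
    then show ?thesis using True B r[of "Suc n"] by (simp add: pos_le_divide_eq)
  next
    case False
    then show ?thesis using r[of "Suc n"] by simp
  qed
  have D_ge: "D (Suc n) \<ge> D 1 * (1 / real (Suc n))" for n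
  proof (induction n)
    case (Suc n)
    have "D 1 \<le> real (Suc n) * D (Suc n)"
      using Suc by (simp add: field_simps)
    also have "\<dots> \<le> (real (Suc (Suc n)) * r (Suc (Suc n))) * D (Suc n)"
      using r_ge[of "Suc n"] D_pos[of "Suc n"] by (intro mult_right_mono) auto
    finally show ?case by (simp add: D_Suc[of "Suc n"] field_simps)
  qed simp
  have S_ge: "S (Suc n) \<ge> D 1 * harm n" for n
  proof -
    have "D 1 * harm n = (\<Sum>k<n. D 1 * (1 / real (Suc k)))"
      by (simp add: harm_altdef sum_distrib_left inverse_eq_divide)
    also have "\<dots> \<le> (\<Sum>k<n. D (Suc k))" by (intro sum_mono D_ge)
    also have "\<dots> \<le> S (Suc n)"
      using D_pos[of 0] unfolding S_def by (subst sum.lessThan_Suc_shift) simp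
    finally show ?thesis .
  qed
  have "filterlim (\<lambda>n. D 1 * harm n) at_top sequentially"
    using D_pos[of 1] harm_at_top by (intro filterlim_tendsto_pos_mult_at_top[OF tendsto_const])
  then have "filterlim (\<lambda>n. S (Suc n)) at_top sequentially"
    by (rule filterlim_at_top_mono) (intro always_eventually allI S_ge)
  then have S_lim: "filterlim S at_top sequentially"
    by (simp add: filterlim_sequentially_Suc)
  \<comment> \<open>With \<open>m = n + 1\<close> this is
    \<open>1 - 2 * B * m / (2 * m + B)\<close>. The indices up to \<open>i0\<close>, with odds 1, do
    not affect the limit.\<close>
  have "(\<lambda>n. real (Suc n) * ((2 * real (Suc n) - B) / (2 * real (Suc n) + B)) - real n) \<longlonglongrightarrow> 1 - B"
    by (real_asymp simp add: field_simps)
  moreover have "eventually (\<lambda>n. real (Suc n) * ((2 * real (Suc n) - B) / (2 * real (Suc n) + B)) - real n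
      = real (Suc n) * r (Suc n) - real n) sequentially"
    using filterlim_real_sequentially[unfolded filterlim_at_top_dense, rule_format, of i0]
    by eventually_elim (simp add: r)
  ultimately have "(\<lambda>n. real (Suc n) * r (Suc n) - real n) \<longlonglongrightarrow> 1 - B"
    by (rule Lim_transform_eventually)
  then have "(\<lambda>n. (\<Sum>k<n. D k * (real (Suc k) * r (Suc k) - real k)) / S n) \<longlonglongrightarrow> 1 - B"
    unfolding S_def
    by (intro weighted_average_tendsto S_lim[unfolded S_def] less_imp_le[OF D_pos])
  \<comment> \<open>The summand is \<open>(k + 1) * D (k + 1) - k * D k\<close>, so the sum
    telescopes.\<close>
  moreover have "(\<Sum>k<n. D k * (real (Suc k) * r (Suc k) - real k)) = real n * D n" for n
    by (induction n) (auto simp: D_Suc algebra_simps)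
  ultimately have a: "(\<lambda>n. real n * D n / S n) \<longlonglongrightarrow> 1 - B" by simp
  have b: "(\<lambda>n. D n / S n) \<longlonglongrightarrow> 0"
  proof -
    have "(\<lambda>n. real n * D n / S n * (1 / real n)) \<longlonglongrightarrow> (1 - B) * 0"
      by (intro tendsto_mult a lim_1_over_n)
    moreover have "eventually (\<lambda>n. real n * D n / S n * (1 / real n) = D n / S n) sequentially"
      using eventually_gt_at_top[of 0] by eventually_elim simp
    ultimately show ?thesis by (simp add: filterlim_cong)
  qed
  \<comment> \<open>\<open>S n\<close> stops before \<open>D n\<close>, whereas the probability has
    \<open>S (n + 1) = S n + D n\<close> below. Dividing numerator and denominator by
    \<open>S n\<close> leaves only known limits; \<open>S 0 = 0\<close>, so the rewriting is claimed
    only eventually.\<close>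
  have "(\<lambda>n. (real n * D n / S n + D n / S n) / (1 + D n / S n)) \<longlonglongrightarrow> (1 - B + 0) / (1 + 0)"
    by (intro tendsto_intros a b) auto
  moreover have "eventually (\<lambda>n. (real n * D n / S n + D n / S n) / (1 + D n / S n) =
      real (Suc n) * (D n / S (Suc n))) sequentially"
    using S_lim[unfolded filterlim_at_top_dense, rule_format, of 0]
  proof eventually_elim
    case (elim n)
    have "1 + D n / S n = S (Suc n) / S n"
      "real n * D n / S n + D n / S n = real (Suc n) * D n / S n"
      using elim by (auto simp: S_def field_simps)
    then show ?case using elim by simp
  qed
  ultimately have "(\<lambda>n. real (Suc n) * (D n / S (Suc n))) \<longlonglongrightarrow> 1 - B"
    by (simp add: filterlim_cong)
  then show ?thesis by (simp only: S_def D_def)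
qed

text \<open>The sum of \<open>x\<close> is the sum of \<open>(k + 1) * x k\<close> with weights
  \<open>1 / (k + 1)\<close>, whose total is a harmonic number and thus comparable to the
  logarithm.\<close>

lemma sum_over_ln_tendsto:
  fixes x :: "nat \<Rightarrow> real"
  assumes "(\<lambda>n. real (Suc n) * x n) \<longlonglongrightarrow> L"
  shows "(\<lambda>n. (\<Sum>k\<le>n. x k) / ln (real n)) \<longlonglongrightarrow> L"
proof -
  have h: "(\<Sum>k<n. 1 / real (Suc k)) = harm n" for n
    by (simp add: harm_altdef inverse_eq_divide)
  have "(\<lambda>n. (\<Sum>k<n. 1 / real (Suc k) * (real (Suc k) * x k)) / (\<Sum>k<n. 1 / real (Suc k))) \<longlonglongrightarrow> L"
    using assms harm_at_top by (intro weighted_average_tendsto) (simp_all only: h, simp)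
  then have "(\<lambda>n. (\<Sum>k<n. x k) / harm n) \<longlonglongrightarrow> L"
    by (simp add: h del: of_nat_Suc)
  then have "(\<lambda>n. (\<Sum>k<Suc n. x k) / harm (Suc n) * (harm (Suc n) / ln (real n))) \<longlonglongrightarrow> L * 1"
    by (intro tendsto_mult harm_over_ln_tendsto) (rule LIMSEQ_Suc)
  moreover have "harm (Suc n) \<noteq> (0::real)" for n
    by (intro less_imp_neq[symmetric] harm_pos) simp
  ultimately show ?thesis
    by (simp add: lessThan_Suc_atMost)
qed

theorem theorem3:
  fixes M :: "'a measure" and Z :: "nat \<Rightarrow> 'a \<Rightarrow> nat"
    and p :: "nat \<Rightarrow> real" and B i0 :: real
  assumes "0 \<le> B" and "B < 1" and "i0 > 0" and "B / (4 * i0) < 1 / 2"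
    and "\<And>i. i \<ge> 1 \<Longrightarrow> p i = (if real i > i0 then 1 / 2 - B / (4 * real i) else 1 / 2)"
    and "branching_with_immigration M p Z"
  shows "(\<exists>c>0. (\<lambda>n. (\<integral>\<omega>. real (card (regeneration_times Z \<omega> \<inter> {0..n})) \<partial>M) / ln (real n))
            \<longlonglongrightarrow> c) \<and>
    (\<forall>\<epsilon>>0. AE \<omega> in M.
       (\<lambda>n. real (card (regeneration_times Z \<omega> \<inter> {0..n})) / ln (real n) powr (1 + \<epsilon>))
         \<longlonglongrightarrow> 0)"
proof -
  interpret branching_with_immigration M p Z by fact
  have lim: "(\<lambda>n. expectation (\<lambda>\<omega>. real (card (regeneration_times Z \<omega> \<inter> {0..n}))) / ln (real n))
      \<longlonglongrightarrow> 1 - B"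
    unfolding expectation_card_regeneration_times
    using odds_prod_over_sum_tendsto[OF assms(1,2,5) odds_prod_pos]
    by (rule sum_over_ln_tendsto)
  moreover have "1 - B > 0" using assms(2) by simp
  ultimately show ?thesis
    using card_regeneration_times_almost_surely[OF lim] by blast
qed

end
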